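(* Let $A$ be a finite alphabet. The algebra of sentences over $A$ (the $\Bbbk$-vector space with basis the set of sentences over $A$) is a bialgebra with multiplication given by concatenation of sentences, comultiplication given by $$\Delta(I)=\sum_{J\subset I}\widetilde{I\setminus J}\otimes\widetilde{J},$$ the natural unit map (sending $1\in\Bbbk$ to the empty sentence $1$), and counit $$\epsilon(I)=\begin{cases}1&\text{if } I=1,\\ 0&\text{otherwise.}\end{cases}$$
   Context: $\Bbbk$ is a field of characteristic zero. A word is a finite sequence of letters of $A$. A sentence $I=(w_1,\dots,w_m)$ is a finite sequence of non-empty words; the empty sentence is denoted by $1$. The concatenation of $I=(w_1,\dots,w_m)$ and $J=(v_1,\dots,v_n)$ is $I\cdot J=(w_1,\dots,w_m,v_1,\dots,v_n)$, extended bilinearly. A weak sentence is a finite sequence of possibly empty words; for a weak sentence $J$, $\widetilde J$ is the sentence obtained by deleting the empty words (the empty sentence if all words are empty). A weak sentence $J=(v_1,\dots,v_m)$ is contained in a sentence $I=(w_1,\dots,w_m)$ of the same length, written $J\subset I$, if there is a weak sentence $I\setminus J:=(u_1,\dots,u_m)$ such that $w_i=u_iv_i$ for all $i=1,\dots,m$. The sum in $\Delta(I)$ is over all weak sentences $J\subset I$. *)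

theory Defs
  imports Complex_Main "HOL-Library.Poly_Mapping"
begin

text \<open>
  The vector space over \<open>'k\<close> with basis \<open>'b\<close> is the type \<open>'b \<Rightarrow>\<^sub>0 'k\<close> of finitely supported
  functions, with \<open>fscale\<close> as its scalar multiplication and \<open>Poly_Mapping.single b 1\<close> as the
  basis vector of \<open>b\<close>.  Abstract vector spaces are given by \<^locale>\<open>vector_space\<close>.
\<close>

definition fscale :: "'k::field \<Rightarrow> ('b \<Rightarrow>\<^sub>0 'k) \<Rightarrow> ('b \<Rightarrow>\<^sub>0 'k)" where
  "fscale c = Poly_Mapping.map (\<lambda>x. c * x)"

lemma lookup_fscale: "Poly_Mapping.lookup (fscale c p) b = c * Poly_Mapping.lookup p b"
  unfolding fscale_def by transfer (simp add: when_def)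

lemma vector_space_fscale: "vector_space (fscale :: 'k::field \<Rightarrow> ('b \<Rightarrow>\<^sub>0 'k) \<Rightarrow> _)"
  by unfold_locales
     (auto intro!: poly_mapping_eqI simp: lookup_fscale lookup_add algebra_simps)

definition linear_extension ::
    "('k::field \<Rightarrow> 'v::ab_group_add \<Rightarrow> 'v) \<Rightarrow> ('b \<Rightarrow> 'v) \<Rightarrow> ('b \<Rightarrow>\<^sub>0 'k) \<Rightarrow> 'v" where
  "linear_extension s f p = (\<Sum>b\<in>Poly_Mapping.keys p. s (Poly_Mapping.lookup p b) (f b))"


section \<open>Tensor products\<close>

text \<open>
  \<open>t :: 'v \<Rightarrow> 'w \<Rightarrow> 't\<close> exhibits \<open>'t\<close> as the tensor product of \<open>'v\<close> and \<open>'w\<close> if it identifies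
  \<open>'t\<close> with the free vector space on \<open>'v \<times> 'w\<close> modulo the span of the bilinearity relations:
  the linear extension of \<open>(v, w) \<mapsto> t v w\<close> is onto, with exactly that span as its kernel.
  This avoids quantifying over all target types, as the universal property would; the latter
  is derived below.
\<close>

definition bilinearity_relations ::
    "('k::field \<Rightarrow> 'v::ab_group_add \<Rightarrow> 'v) \<Rightarrow> ('k \<Rightarrow> 'w::ab_group_add \<Rightarrow> 'w) \<Rightarrow> ('v \<times> 'w \<Rightarrow>\<^sub>0 'k) set" where
  "bilinearity_relations sV sW =
     {Poly_Mapping.single (v + v', w) 1 - Poly_Mapping.single (v, w) 1 - Poly_Mapping.single (v', w) 1
        | v v' w. True} \<union>
     {Poly_Mapping.single (v, w + w') 1 - Poly_Mapping.single (v, w) 1 - Poly_Mapping.single (v, w') 1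
        | v w w'. True} \<union>
     {Poly_Mapping.single (sV c v, w) 1 - Poly_Mapping.single (v, w) c | c v w. True} \<union>
     {Poly_Mapping.single (v, sW c w) 1 - Poly_Mapping.single (v, w) c | c v w. True}"

locale tensor_product =
  V: vector_space sV + W: vector_space sW + T: vector_space sT
  for sV :: "'k::field \<Rightarrow> 'v::ab_group_add \<Rightarrow> 'v"
    and sW :: "'k \<Rightarrow> 'w::ab_group_add \<Rightarrow> 'w"
    and sT :: "'k \<Rightarrow> 't::ab_group_add \<Rightarrow> 't" +
  fixes t :: "'v \<Rightarrow> 'w \<Rightarrow> 't"
  assumes tensor_surj: "surj (linear_extension sT (\<lambda>(v, w). t v w))"
    and tensor_kernel: "{p. linear_extension sT (\<lambda>(v, w). t v w) p = 0} =
          module.span fscale (bilinearity_relations sV sW)"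

definition bilinear_map ::
    "('k::field \<Rightarrow> 'u::ab_group_add \<Rightarrow> 'u) \<Rightarrow> ('k \<Rightarrow> 'v::ab_group_add \<Rightarrow> 'v) \<Rightarrow>
     ('k \<Rightarrow> 'w::ab_group_add \<Rightarrow> 'w) \<Rightarrow> ('u \<Rightarrow> 'v \<Rightarrow> 'w) \<Rightarrow> bool" where
  "bilinear_map sU sV sW b \<longleftrightarrow>
     (\<forall>x. Vector_Spaces.linear sV sW (b x)) \<and> (\<forall>y. Vector_Spaces.linear sU sW (\<lambda>x. b x y))"

text \<open>The linear map on the tensor product \<open>'t\<close> induced by a bilinear map \<open>b\<close>.\<close>

definition tensor_lift ::
    "('k::field \<Rightarrow> 't::ab_group_add \<Rightarrow> 't) \<Rightarrow> ('v \<Rightarrow> 'w \<Rightarrow> 't) \<Rightarrow>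
     ('k \<Rightarrow> 'u::ab_group_add \<Rightarrow> 'u) \<Rightarrow> ('v \<Rightarrow> 'w \<Rightarrow> 'u) \<Rightarrow> 't \<Rightarrow> 'u" where
  "tensor_lift sT t sU b = (THE h. Vector_Spaces.linear sT sU h \<and> (\<forall>v w. h (t v w) = b v w))"

lemma linear_extension_superset:
  assumes "vector_space s" "finite B" "Poly_Mapping.keys p \<subseteq> B"
  shows "linear_extension s f p = (\<Sum>b\<in>B. s (Poly_Mapping.lookup p b) (f b))"
proof -
  interpret vector_space s by fact
  show ?thesis
    unfolding linear_extension_def
    by (rule sum.mono_neutral_left) (use assms in \<open>auto simp: in_keys_iff\<close>)
qed

lemma linear_linear_extension:
  fixes s :: "'k::field \<Rightarrow> 'v::ab_group_add \<Rightarrow> 'v" and f :: "'b \<Rightarrow> 'v"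
  assumes "vector_space s"
  shows "Vector_Spaces.linear fscale s (linear_extension s f)"
proof -
  interpret S: vector_space s by fact
  interpret F: vector_space fscale by (rule vector_space_fscale)
  show ?thesis
  proof
    fix p q :: "'b \<Rightarrow>\<^sub>0 'k"
    let ?B = "Poly_Mapping.keys p \<union> Poly_Mapping.keys q"
    have "linear_extension s f (p + q) = (\<Sum>b\<in>?B. s (Poly_Mapping.lookup (p + q) b) (f b))"
      by (rule linear_extension_superset[OF assms]) (auto dest: subsetD[OF keys_add])
    moreover have "linear_extension s f p = (\<Sum>b\<in>?B. s (Poly_Mapping.lookup p b) (f b))"
      "linear_extension s f q = (\<Sum>b\<in>?B. s (Poly_Mapping.lookup q b) (f b))"
      by (rule linear_extension_superset[OF assms]; auto)+
    ultimately show "linear_extension s f (p + q) = linear_extension s f p + linear_extension s f q"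
      by (simp add: lookup_add S.scale_left_distrib sum.distrib)
  next
    fix c and p :: "'b \<Rightarrow>\<^sub>0 'k"
    have "linear_extension s f (fscale c p) = (\<Sum>b\<in>Poly_Mapping.keys p. s (Poly_Mapping.lookup (fscale c p) b) (f b))"
      by (rule linear_extension_superset[OF assms]) (auto simp: in_keys_iff lookup_fscale)
    then show "linear_extension s f (fscale c p) = s c (linear_extension s f p)"
      by (simp add: lookup_fscale linear_extension_def S.scale_sum_right)
  qed
qed

lemma linear_extension_single:
  assumes "vector_space s"
  shows "linear_extension s f (Poly_Mapping.single b c) = s c (f b)"
proof -
  interpret vector_space s by fact
  show ?thesis
    by (subst linear_extension_superset[OF assms, of "{b}"]) auto
qed

context tensor_product
begin

abbreviation (input) "quot \<equiv> linear_extension sT (\<lambda>(v, w). t v w)"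

lemma quot_single: "quot (Poly_Mapping.single (v, w) c) = sT c (t v w)"
  by (simp add: linear_extension_single[OF T.vector_space_axioms])

lemma relation_zero:
  assumes "p \<in> bilinearity_relations sV sW"
  shows "quot p = 0"
proof -
  interpret F: vector_space fscale by (rule vector_space_fscale)
  show ?thesis using F.span_base[OF assms] tensor_kernel by blast
qed

lemma bilinear_map_tensor: "bilinear_map sV sW sT t"
proof -
  interpret Q: Vector_Spaces.linear fscale sT quot
    by (rule linear_linear_extension[OF T.vector_space_axioms])
  have 1: "t (v + v') w = t v w + t v' w" for v v' w
  proof -
    have "quot (Poly_Mapping.single (v + v', w) 1 - Poly_Mapping.single (v, w) 1
            - Poly_Mapping.single (v', w) 1) = 0"
      by (rule relation_zero, unfold bilinearity_relations_def) blast
    then show ?thesis by (simp add: Q.diff Q.add quot_single algebra_simps)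
  qed
  have 2: "t v (w + w') = t v w + t v w'" for v w w'
  proof -
    have "quot (Poly_Mapping.single (v, w + w') 1 - Poly_Mapping.single (v, w) 1
            - Poly_Mapping.single (v, w') 1) = 0"
      by (rule relation_zero, unfold bilinearity_relations_def) blast
    then show ?thesis by (simp add: Q.diff Q.add quot_single algebra_simps)
  qed
  have 3: "t (sV c v) w = sT c (t v w)" for c v w
  proof -
    have "quot (Poly_Mapping.single (sV c v, w) 1 - Poly_Mapping.single (v, w) c) = 0"
      by (rule relation_zero, unfold bilinearity_relations_def) blast
    then show ?thesis by (simp add: Q.diff quot_single)
  qed
  have 4: "t v (sW c w) = sT c (t v w)" for c v w
  proof -
    have "quot (Poly_Mapping.single (v, sW c w) 1 - Poly_Mapping.single (v, w) c) = 0"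
      by (rule relation_zero, unfold bilinearity_relations_def) blast
    then show ?thesis by (simp add: Q.diff quot_single)
  qed
  show ?thesis
    unfolding bilinear_map_def
    by (intro conjI allI; unfold_locales; simp add: 1 2 3 4)
qed

theorem universal_property:
  assumes U: "vector_space sU" and b: "bilinear_map sV sW sU b"
  shows "\<exists>!h. Vector_Spaces.linear sT sU h \<and> (\<forall>v w. h (t v w) = b v w)"
proof -
  interpret U: vector_space sU by fact
  interpret F: vector_space fscale by (rule vector_space_fscale)
  interpret Q: Vector_Spaces.linear fscale sT quot
    by (rule linear_linear_extension[OF T.vector_space_axioms])
  define B where "B = linear_extension sU (\<lambda>(v, w). b v w)"
  interpret B: Vector_Spaces.linear fscale sU B
    unfolding B_def by (rule linear_linear_extension[OF U])
  have B_single: "B (Poly_Mapping.single (v, w) c) = sU c (b v w)" for v w c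
    by (simp add: B_def linear_extension_single[OF U])
  have l: "Vector_Spaces.linear sW sU (b x)" "Vector_Spaces.linear sV sU (\<lambda>x. b x y)" for x y
    using b by (auto simp: bilinear_map_def)
  note hom = l[unfolded linear_iff_module_hom]
  have B_rel: "B p = 0" if "p \<in> bilinearity_relations sV sW" for p
    using that module_hom.add[OF hom(1)] module_hom.add[OF hom(2)]
      module_hom.scale[OF hom(1)] module_hom.scale[OF hom(2)]
    by (auto simp: bilinearity_relations_def B.diff B_single)
  have B_ker: "B p = 0" if "quot p = 0" for p
    using B.eq_0_on_span[OF B_rel] that tensor_kernel by blast
  have B_eq: "B p = B q" if "quot p = quot q" for p q
    using B_ker[of "p - q"] that by (simp add: Q.diff B.diff)
  define h where "h x = B (inv quot x)" for x
  have h_quot: "h (quot p) = B p" for p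
    unfolding h_def by (rule B_eq) (simp add: surj_f_inv_f[OF tensor_surj])
  show ?thesis
  proof (rule ex1I, intro conjI allI)
    show "Vector_Spaces.linear sT sU h"
    proof
      fix x y c
      obtain p q where pq: "x = quot p" "y = quot q" using tensor_surj by (meson surjD)
      show "h (x + y) = h x + h y" unfolding pq Q.add[symmetric] h_quot B.add ..
      show "h (sT c x) = sU c (h x)" unfolding pq Q.scale[symmetric] h_quot B.scale ..
    qed
    show "h (t v w) = b v w" for v w
      using h_quot[of "Poly_Mapping.single (v, w) 1"] by (simp add: quot_single B_single)
  next
    fix g assume g: "Vector_Spaces.linear sT sU g \<and> (\<forall>v w. g (t v w) = b v w)"
    interpret g: Vector_Spaces.linear sT sU g using g by blast
    show "g = h"
    proof
      fix x
      obtain p where p: "x = quot p" using tensor_surj by (meson surjD)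
      have "g x = B p"
        unfolding p B_def linear_extension_def
        by (auto simp: g.sum g.scale g intro!: sum.cong split: prod.split)
      then show "g x = h x" by (simp add: p h_quot)
    qed
  qed
qed

lemma tensor_lift_unique:
  assumes "vector_space sU" "bilinear_map sV sW sU b"
    and "Vector_Spaces.linear sT sU h" "\<And>v w. h (t v w) = b v w"
  shows "tensor_lift sT t sU b = h"
  unfolding tensor_lift_def
  by (rule the1_equality[OF universal_property[OF assms(1,2)]]) (use assms(3,4) in blast)

end

text \<open>\<open>f \<otimes> g\<close> for linear maps \<open>f\<close> and \<open>g\<close>.\<close>

definition tensor_map ::
    "('k::field \<Rightarrow> 't::ab_group_add \<Rightarrow> 't) \<Rightarrow> ('v \<Rightarrow> 'w \<Rightarrow> 't) \<Rightarrow>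
     ('k \<Rightarrow> 'u::ab_group_add \<Rightarrow> 'u) \<Rightarrow> ('x \<Rightarrow> 'y \<Rightarrow> 'u) \<Rightarrow>
     ('v \<Rightarrow> 'x) \<Rightarrow> ('w \<Rightarrow> 'y) \<Rightarrow> 't \<Rightarrow> 'u" where
  "tensor_map sT t sU u f g = tensor_lift sT t sU (\<lambda>v w. u (f v) (g w))"

text \<open>
  The associator \<open>(V \<otimes> V) \<otimes> V \<rightarrow> V \<otimes> (V \<otimes> V)\<close>, where \<open>t\<close>, \<open>tL\<close> and \<open>tR\<close> are the tensor maps of
  \<open>V \<otimes> V\<close>, \<open>(V \<otimes> V) \<otimes> V\<close> and \<open>V \<otimes> (V \<otimes> V)\<close>.
\<close>

definition tensor_assoc ::
    "('k::field \<Rightarrow> 't::ab_group_add \<Rightarrow> 't) \<Rightarrow> ('v \<Rightarrow> 'v \<Rightarrow> 't) \<Rightarrow>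
     ('k \<Rightarrow> 'tl::ab_group_add \<Rightarrow> 'tl) \<Rightarrow> ('t \<Rightarrow> 'v \<Rightarrow> 'tl) \<Rightarrow>
     ('k \<Rightarrow> 'tr::ab_group_add \<Rightarrow> 'tr) \<Rightarrow> ('v \<Rightarrow> 't \<Rightarrow> 'tr) \<Rightarrow> 'tl \<Rightarrow> 'tr" where
  "tensor_assoc sT t sL tL sR tR =
     tensor_lift sL tL sR (\<lambda>p z. tensor_lift sT t sR (\<lambda>x y. tR x (t y z)) p)"

text \<open>The product of \<open>V \<otimes> V\<close> with \<open>(a \<otimes> b) (c \<otimes> d) = a c \<otimes> b d\<close>.\<close>

definition tensor_mult ::
    "('k::field \<Rightarrow> 't::ab_group_add \<Rightarrow> 't) \<Rightarrow> ('v \<Rightarrow> 'v \<Rightarrow> 't) \<Rightarrow> ('v \<Rightarrow> 'v \<Rightarrow> 'v) \<Rightarrow> 't \<Rightarrow> 't \<Rightarrow> 't" where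
  "tensor_mult sT t m p q =
     tensor_lift sT t sT (\<lambda>a b. tensor_lift sT t sT (\<lambda>c d. t (m a c) (m b d)) q) p"


section \<open>Bialgebras\<close>

text \<open>
  A multiplication is given as a bilinear map \<open>V \<times> V \<rightarrow> V\<close>.  A comultiplication takes values in
  a given tensor product \<open>V \<otimes> V\<close>; the two threefold tensor products are needed for
  coassociativity only.
\<close>

locale unital_algebra = V: vector_space s
  for s :: "'k::field \<Rightarrow> 'v::ab_group_add \<Rightarrow> 'v" +
  fixes mult :: "'v \<Rightarrow> 'v \<Rightarrow> 'v" and unit :: "'k \<Rightarrow> 'v"
  assumes bilinear_mult: "bilinear_map s s s mult"
    and linear_unit: "Vector_Spaces.linear (*) s unit"
    and mult_assoc: "mult (mult x y) z = mult x (mult y z)"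
    and mult_unit_left: "mult (unit c) x = s c x"
    and mult_unit_right: "mult x (unit c) = s c x"

locale coalgebra =
  VV: tensor_product s s sT t +
  VV_V: tensor_product sT s sL tL +
  V_VV: tensor_product s sT sR tR
  for s :: "'k::field \<Rightarrow> 'v::ab_group_add \<Rightarrow> 'v"
    and sT :: "'k \<Rightarrow> 't::ab_group_add \<Rightarrow> 't" and t :: "'v \<Rightarrow> 'v \<Rightarrow> 't"
    and sL :: "'k \<Rightarrow> 'tl::ab_group_add \<Rightarrow> 'tl" and tL :: "'t \<Rightarrow> 'v \<Rightarrow> 'tl"
    and sR :: "'k \<Rightarrow> 'tr::ab_group_add \<Rightarrow> 'tr" and tR :: "'v \<Rightarrow> 't \<Rightarrow> 'tr" +
  fixes comult :: "'v \<Rightarrow> 't" and counit :: "'v \<Rightarrow> 'k"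
  assumes linear_comult: "Vector_Spaces.linear s sT comult"
    and linear_counit: "Vector_Spaces.linear s (*) counit"
    and coassoc: "tensor_assoc sT t sL tL sR tR (tensor_map sT t sL tL comult id (comult x)) =
          tensor_map sT t sR tR id comult (comult x)"
    \<comment> \<open>\<open>(\<epsilon> \<otimes> id) \<circ> \<Delta>\<close> and \<open>(id \<otimes> \<epsilon>) \<circ> \<Delta>\<close>, with \<open>k \<otimes> V\<close> and \<open>V \<otimes> k\<close> identified with \<open>V\<close>\<close>
    and counit_left: "tensor_lift sT t s (\<lambda>v w. s (counit v) w) (comult x) = x"
    and counit_right: "tensor_lift sT t s (\<lambda>v w. s (counit w) v) (comult x) = x"

locale bialgebra =
  unital_algebra s mult unit + coalgebra s sT t sL tL sR tR comult counit
  for s :: "'k::field \<Rightarrow> 'v::ab_group_add \<Rightarrow> 'v"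
    and sT :: "'k \<Rightarrow> 't::ab_group_add \<Rightarrow> 't" and t :: "'v \<Rightarrow> 'v \<Rightarrow> 't"
    and sL :: "'k \<Rightarrow> 'tl::ab_group_add \<Rightarrow> 'tl" and tL :: "'t \<Rightarrow> 'v \<Rightarrow> 'tl"
    and sR :: "'k \<Rightarrow> 'tr::ab_group_add \<Rightarrow> 'tr" and tR :: "'v \<Rightarrow> 't \<Rightarrow> 'tr"
    and mult :: "'v \<Rightarrow> 'v \<Rightarrow> 'v" and unit :: "'k \<Rightarrow> 'v"
    and comult :: "'v \<Rightarrow> 't" and counit :: "'v \<Rightarrow> 'k" +
  assumes comult_mult: "comult (mult x y) = tensor_mult sT t mult (comult x) (comult y)"
    and comult_unit: "comult (unit 1) = t (unit 1) (unit 1)"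
    and counit_mult: "counit (mult x y) = counit x * counit y"
    and counit_unit: "counit (unit 1) = 1"

text \<open>
  The tensor product of free vector spaces, \<open>(\<Sum>\<^sub>b p\<^sub>b b) \<otimes> (\<Sum>\<^sub>c q\<^sub>c c) = \<Sum>\<^sub>b\<^sub>,\<^sub>c p\<^sub>b q\<^sub>c (b, c)\<close>.
\<close>

lift_definition ftensor :: "('b \<Rightarrow>\<^sub>0 'k::field) \<Rightarrow> ('c \<Rightarrow>\<^sub>0 'k) \<Rightarrow> ('b \<times> 'c \<Rightarrow>\<^sub>0 'k)" is
  "\<lambda>p q (b, c). p b * q c"
proof -
  fix p :: "'b \<Rightarrow> 'k" and q :: "'c \<Rightarrow> 'k"
  assume fin: "finite {b. p b \<noteq> 0}" "finite {c. q c \<noteq> 0}"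
  show "finite {x. (case x of (b, c) \<Rightarrow> p b * q c) \<noteq> 0}"
    by (rule finite_subset[OF _ finite_cartesian_product[OF fin]]) auto
qed


section \<open>The algebra of sentences\<close>

text \<open>Words are lists of letters, and weak sentences are lists of words.\<close>

typedef 'a sentence = "{I :: 'a list list. [] \<notin> set I}"
  morphisms words Sentence
  by (rule exI[of _ "[]"]) simp

setup_lifting type_definition_sentence

text \<open>
  Sentences under concatenation form a monoid, written additively: \<open>0\<close> is the empty sentence
  and \<open>I + J\<close> is \<open>I \<cdot> J\<close>.  With this notation \<open>'a sentence \<Rightarrow>\<^sub>0 'k\<close> is the monoid algebra of
  \<^theory>\<open>HOL-Library.Poly_Mapping\<close>, whose product \<open>(*)\<close> extends concatenation bilinearly.
\<close>

instantiation sentence :: (type) monoid_add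
begin

lift_definition zero_sentence :: "'a sentence" is "[]" by simp
lift_definition plus_sentence :: "'a sentence \<Rightarrow> 'a sentence \<Rightarrow> 'a sentence" is "(@)" by simp

instance by standard (transfer, simp)+

end

type_synonym ('a, 'k) sentence_algebra = "'a sentence \<Rightarrow>\<^sub>0 'k"

lift_definition drop_empty_words :: "'a list list \<Rightarrow> 'a sentence" is "filter (\<lambda>w. w \<noteq> [])"
  by simp

text \<open>\<open>factors I U J\<close>: \<open>w\<^sub>i = u\<^sub>i v\<^sub>i\<close> for all \<open>i\<close>, where \<open>I = (w\<^sub>i)\<close>, \<open>U = (u\<^sub>i)\<close>, \<open>J = (v\<^sub>i)\<close>.\<close>

definition factors :: "'a list list \<Rightarrow> 'a list list \<Rightarrow> 'a list list \<Rightarrow> bool" where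
  "factors I U J \<longleftrightarrow> length U = length I \<and> length J = length I \<and> (\<forall>i<length I. I ! i = U ! i @ J ! i)"

definition contained :: "'a list list \<Rightarrow> 'a sentence \<Rightarrow> bool" where
  "contained J I \<longleftrightarrow> (\<exists>U. factors (words I) U J)"

definition remainder :: "'a sentence \<Rightarrow> 'a list list \<Rightarrow> 'a list list" where
  "remainder I J = (THE U. factors (words I) U J)"

lemma remainder_eqI: "factors (words I) U J \<Longrightarrow> remainder I J = U"
  unfolding remainder_def
  by (rule the_equality) (auto simp: factors_def intro!: nth_equalityI)

lemma finite_contained: "finite {J. contained J I}"
proof (rule finite_subset)
  let ?S = "\<Union>w\<in>set (words I). (\<lambda>n. drop n w) ` {..length w}"
  show "{J. contained J I} \<subseteq> {J. set J \<subseteq> ?S \<and> length J = length (words I)}"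
  proof safe
    fix J v assume "contained J I" "v \<in> set J"
    then obtain U i where U: "factors (words I) U J" and i: "i < length J" "v = J ! i"
      by (auto simp: contained_def in_set_conv_nth)
    let ?w = "words I ! i"
    have len: "i < length (words I)" using U i by (auto simp: factors_def)
    have w: "?w = U ! i @ v" "?w \<in> set (words I)"
      using U i len nth_mem[OF len] by (auto simp: factors_def simp del: nth_mem)
    then have "v = drop (length (U ! i)) ?w" "length (U ! i) \<le> length ?w" by auto
    with w(2) show "v \<in> ?S" by blast
  qed (auto simp: contained_def factors_def)
  show "finite {J. set J \<subseteq> ?S \<and> length J = length (words I)}"
    by (rule finite_lists_length_eq) auto
qed

definition sentence_unit :: "'k::field \<Rightarrow> ('a, 'k) sentence_algebra" where
  "sentence_unit c = Poly_Mapping.single 0 c"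

definition sentence_comult :: "('a, 'k::field) sentence_algebra \<Rightarrow> ('a sentence \<times> 'a sentence \<Rightarrow>\<^sub>0 'k)" where
  "sentence_comult = linear_extension fscale
     (\<lambda>I. \<Sum>J\<in>{J. contained J I}.
        ftensor (Poly_Mapping.single (drop_empty_words (remainder I J)) 1)
          (Poly_Mapping.single (drop_empty_words J) 1))"

definition sentence_counit :: "('a, 'k::field) sentence_algebra \<Rightarrow> 'k" where
  "sentence_counit = linear_extension (*) (\<lambda>I. if I = 0 then 1 else 0)"

end

theory Submission
  imports Defs "HOL-Library.Product_Plus"
begin

text \<open>
  The coproduct of a weak sentence sums over the ways of cutting each of its words in two.  Both
  iterated coproducts sum over the ways of cutting each word in three, which gives coassociativity:
  deleting the empty words of a half before cutting it again changes nothing, as an empty word can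
  be cut in one way only and contributes nothing.  In the counit laws only the terms survive
  in which all words of one half are empty.  Cutting \<open>I \<cdot> J\<close> amounts to cutting \<open>I\<close>
  and \<open>J\<close> independently, so the coproduct is multiplicative.
\<close>

section \<open>Linear maps on free vector spaces\<close>

lemmas linearI = Vector_Spaces.linear_iff[THEN iffD2,
    OF conjI[OF _ conjI[OF _ conjI[OF allI[OF allI] allI[OF allI]]]]]

lemma linear_addD: "Vector_Spaces.linear s1 s2 f \<Longrightarrow> f (x + y) = f x + f y"
  by (simp add: linear_iff_module_hom module_hom.add)

lemma linear_scaleD: "Vector_Spaces.linear s1 s2 f \<Longrightarrow> f (s1 c x) = s2 c (f x)"
  by (simp add: linear_iff_module_hom module_hom.scale)

lemma linear_sumD: "Vector_Spaces.linear s1 s2 f \<Longrightarrow> f (sum g A) = (\<Sum>x\<in>A. f (g x))"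
  by (simp add: linear_iff_module_hom module_hom.sum)

lemma linear_compose:
  assumes "Vector_Spaces.linear s1 s2 f" "Vector_Spaces.linear s2 s3 g"
  shows "Vector_Spaces.linear s1 s3 (\<lambda>x. g (f x))"
  using Vector_Spaces.linear_compose[OF assms] by (simp add: o_def)

lemma vector_space_times: "vector_space ((*) :: 'k::field \<Rightarrow> 'k \<Rightarrow> 'k)"
  by unfold_locales (auto simp: algebra_simps)

lemma fscale_single [simp]: "fscale c (Poly_Mapping.single b d) = Poly_Mapping.single b (c * d)"
  by (rule poly_mapping_eqI) (simp add: lookup_fscale lookup_single when_def)

lemma fscale_one [simp]: "fscale 1 p = p"
  by (rule poly_mapping_eqI) (simp add: lookup_fscale)

lemma linear_extension_id: "linear_extension fscale (\<lambda>b. Poly_Mapping.single b 1) p = p"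
  by (rule poly_mapping_eqI)
    (simp add: linear_extension_def lookup_sum lookup_single when_def in_keys_iff)

text \<open>Every finitely supported function is a finite sum of multiples of basis vectors, so
  additivity of \<open>P\<close> carries it from those multiples to all of the space.\<close>

lemma poly_mapping_single_induct [case_names single sum]:
  fixes p :: "'b \<Rightarrow>\<^sub>0 'k::field"
  assumes single: "\<And>b c. P (Poly_Mapping.single b c)"
    and sum: "\<And>p q. P p \<Longrightarrow> P q \<Longrightarrow> P (p + q)"
  shows "P p"
proof -
  have "P (\<Sum>b\<in>B. Poly_Mapping.single b (Poly_Mapping.lookup p b))" for B
    by (induction B rule: infinite_finite_induct)
      \<comment> \<open>The empty sum is a basis vector with coefficient 0, so \<open>single\<close>
        covers it and no separate case for 0 arises.\<close>
      (use single[of undefined 0] in \<open>auto intro: single sum\<close>)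
  then have "P (linear_extension fscale (\<lambda>b. Poly_Mapping.single b 1) p)"
    by (simp add: linear_extension_def)
  then show ?thesis by (simp only: linear_extension_id)
qed

lemma linear_eq_on_basis:
  assumes f: "Vector_Spaces.linear fscale s f" and g: "Vector_Spaces.linear fscale s g"
    and eq: "\<And>b. f (Poly_Mapping.single b 1) = g (Poly_Mapping.single b 1)"
  shows "f p = g p"
proof -
  have "f (linear_extension fscale (\<lambda>b. Poly_Mapping.single b 1) p) =
      g (linear_extension fscale (\<lambda>b. Poly_Mapping.single b 1) p)"
    by (simp only: linear_extension_def linear_sumD[OF f] linear_sumD[OF g]
        linear_scaleD[OF f] linear_scaleD[OF g] eq)
  then show ?thesis by (simp add: linear_extension_id)
qed

text \<open>This is linearity in a parameter of the basis values, with the argument \<open>p\<close>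
  fixed. Nested tensor lifts depend on their outer arguments in this way.\<close>

lemma linear_linear_extension_param:
  assumes F: "\<And>b. Vector_Spaces.linear s1 s2 (\<lambda>a. F a b)"
  shows "Vector_Spaces.linear s1 s2 (\<lambda>a. linear_extension s2 (F a) p)"
proof -
  \<comment> \<open>The index is arbitrary: the interpretation supplies that \<open>s1\<close> and
    \<open>s2\<close> are scalar multiplications of vector spaces.\<close>
  interpret F: Vector_Spaces.linear s1 s2 "\<lambda>a. F a undefined" by (rule F)
  show ?thesis
    by (rule linearI)
      (unfold_locales, simp_all add: linear_extension_def linear_addD[OF F] linear_scaleD[OF F]
        F.vs2.scale_right_distrib sum.distrib F.vs2.scale_sum_right mult.commute)
qed

section \<open>The tensor product of free vector spaces\<close>

lemma lookup_ftensor [simp]: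
  "Poly_Mapping.lookup (ftensor p q) (b, c) = Poly_Mapping.lookup p b * Poly_Mapping.lookup q c"
  by transfer simp

lemma ftensor_single [simp]:
  "ftensor (Poly_Mapping.single b x) (Poly_Mapping.single c y) = Poly_Mapping.single (b, c) (x * y)"
proof (rule poly_mapping_eqI)
  fix k
  show "Poly_Mapping.lookup (ftensor (Poly_Mapping.single b x) (Poly_Mapping.single c y)) k =
      Poly_Mapping.lookup (Poly_Mapping.single (b, c) (x * y)) k"
    by (cases k) (simp add: lookup_single when_def)
qed

lemma bilinear_ftensor: "bilinear_map fscale fscale fscale ftensor"
  unfolding bilinear_map_def
  by (intro conjI allI; rule linearI; (rule vector_space_fscale)?)
    (auto intro!: poly_mapping_eqI simp: lookup_add lookup_fscale algebra_simps)

lemmas ftensor_linear_right = bilinear_ftensor[unfolded bilinear_map_def, THEN conjunct1, rule_format]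
lemmas ftensor_linear_left = bilinear_ftensor[unfolded bilinear_map_def, THEN conjunct2, rule_format]

text \<open>The quotient map \<open>?q\<close> has a linear section \<open>\<Phi>\<close>, hence is
  onto. Modulo the bilinearity relations every \<open>p\<close> equals \<open>\<Phi> (?q p)\<close>,
  so an element killed by \<open>?q\<close> lies in their span. Conversely, bilinearity of
  \<open>ftensor\<close> kills the relations.\<close>

lemma tensor_product_ftensor:
  "tensor_product fscale fscale fscale
     (ftensor :: ('b \<Rightarrow>\<^sub>0 'k::field) \<Rightarrow> ('c \<Rightarrow>\<^sub>0 'k) \<Rightarrow> ('b \<times> 'c \<Rightarrow>\<^sub>0 'k))"
proof -
  let ?t = "ftensor :: ('b \<Rightarrow>\<^sub>0 'k) \<Rightarrow> ('c \<Rightarrow>\<^sub>0 'k) \<Rightarrow> ('b \<times> 'c \<Rightarrow>\<^sub>0 'k)"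
  let ?q = "linear_extension fscale (\<lambda>(v, w). ?t v w)"
  let ?R = "bilinearity_relations fscale fscale :: ((('b \<Rightarrow>\<^sub>0 'k) \<times> ('c \<Rightarrow>\<^sub>0 'k)) \<Rightarrow>\<^sub>0 'k) set"
  define \<Phi> :: "('b \<times> 'c \<Rightarrow>\<^sub>0 'k) \<Rightarrow> (('b \<Rightarrow>\<^sub>0 'k) \<times> ('c \<Rightarrow>\<^sub>0 'k) \<Rightarrow>\<^sub>0 'k)" where
    "\<Phi> = linear_extension fscale
      (\<lambda>(b, c). Poly_Mapping.single (Poly_Mapping.single b 1, Poly_Mapping.single c 1) 1)"
  interpret F: vector_space "fscale :: 'k \<Rightarrow> ((('b \<Rightarrow>\<^sub>0 'k) \<times> ('c \<Rightarrow>\<^sub>0 'k)) \<Rightarrow>\<^sub>0 'k) \<Rightarrow> _"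
    by (rule vector_space_fscale)
  interpret Q: Vector_Spaces.linear fscale fscale ?q
    by (rule linear_linear_extension[OF vector_space_fscale])
  interpret P: Vector_Spaces.linear fscale fscale \<Phi>
    unfolding \<Phi>_def by (rule linear_linear_extension[OF vector_space_fscale])
  have q_single: "?q (Poly_Mapping.single (v, w) c) = fscale c (?t v w)" for v w c
    by (simp add: linear_extension_single[OF vector_space_fscale])
  have \<Phi>_single: "\<Phi> (Poly_Mapping.single (b, c) x) =
      Poly_Mapping.single (Poly_Mapping.single b 1, Poly_Mapping.single c 1) x" for b c x
    by (simp add: \<Phi>_def linear_extension_single[OF vector_space_fscale])
  have q\<Phi>: "?q (\<Phi> p) = p" for p
    by (rule linear_eq_on_basis[OF linear_compose[OF P.linear_axioms Q.linear_axioms]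
          linear_linear_extension[OF vector_space_fscale, of "\<lambda>b. Poly_Mapping.single b 1"],
          unfolded linear_extension_id])
      (auto simp: \<Phi>_single q_single split: prod.split)
  \<comment> \<open>\<open>E v w\<close> is the difference between the generator
    \<open>(v, w)\<close> and its expansion into pairs of basis vectors. The relations say exactly
    what is needed to move sums and scalars out of either argument.\<close>
  define E where "E v w = Poly_Mapping.single (v, w) 1 - \<Phi> (?t v w)" for v w
  note t_add = linear_addD[OF ftensor_linear_left] linear_addD[OF ftensor_linear_right]
  note t_scale = linear_scaleD[OF ftensor_linear_left] linear_scaleD[OF ftensor_linear_right]
  have addL: "E (v + v') w \<in> F.span ?R" if "E v w \<in> F.span ?R" "E v' w \<in> F.span ?R" for v v' w
  proof -
    have "Poly_Mapping.single (v + v', w) 1 - Poly_Mapping.single (v, w) 1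
        - Poly_Mapping.single (v', w) 1 \<in> F.span ?R"
      by (rule F.span_base, unfold bilinearity_relations_def) blast
    from F.span_add[OF this F.span_add[OF that]] show ?thesis
      by (simp add: E_def t_add P.add algebra_simps)
  qed
  have addR: "E v (w + w') \<in> F.span ?R" if "E v w \<in> F.span ?R" "E v w' \<in> F.span ?R" for v w w'
  proof -
    have "Poly_Mapping.single (v, w + w') 1 - Poly_Mapping.single (v, w) 1
        - Poly_Mapping.single (v, w') 1 \<in> F.span ?R"
      by (rule F.span_base, unfold bilinearity_relations_def) blast
    from F.span_add[OF this F.span_add[OF that]] show ?thesis
      by (simp add: E_def t_add P.add algebra_simps)
  qed
  have scaleL: "E (fscale c v) w \<in> F.span ?R" if "E v w \<in> F.span ?R" for c v w
  proof -
    have "Poly_Mapping.single (fscale c v, w) 1 - Poly_Mapping.single (v, w) c \<in> F.span ?R"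
      by (rule F.span_base, unfold bilinearity_relations_def) blast
    from F.span_add[OF this F.span_scale[OF that, of c]] show ?thesis
      by (simp add: E_def t_scale P.scale F.scale_right_diff_distrib algebra_simps)
  qed
  have scaleR: "E v (fscale c w) \<in> F.span ?R" if "E v w \<in> F.span ?R" for c v w
  proof -
    have "Poly_Mapping.single (v, fscale c w) 1 - Poly_Mapping.single (v, w) c \<in> F.span ?R"
      by (rule F.span_base, unfold bilinearity_relations_def) blast
    from F.span_add[OF this F.span_scale[OF that, of c]] show ?thesis
      by (simp add: E_def t_scale P.scale F.scale_right_diff_distrib algebra_simps)
  qed
  \<comment> \<open>A pair of basis vectors is its own expansion, so the difference
    vanishes.\<close>
  have base: "E (Poly_Mapping.single b 1) (Poly_Mapping.single c 1) \<in> F.span ?R" for b c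
    by (simp add: E_def \<Phi>_single F.span_zero)
  have singles: "E (Poly_Mapping.single b x) (Poly_Mapping.single c y) \<in> F.span ?R" for b c x y
    using scaleL[OF scaleR[OF base], where c = x] by simp
  \<comment> \<open>Additivity extends the claim from multiples of basis vectors to all vectors,
    first in the second argument and then in the first.\<close>
  have "E (Poly_Mapping.single b x) w \<in> F.span ?R" for b x w
    by (induction w rule: poly_mapping_single_induct) (auto intro: singles addR)
  then have E: "E v w \<in> F.span ?R" for v w
    by (induction v rule: poly_mapping_single_induct) (auto intro: addL)
  \<comment> \<open>The expression is additive in \<open>p\<close>, and for a generator with
    coefficient \<open>c\<close> it is \<open>c\<close> times the corresponding
    \<open>E v w\<close>.\<close>
  have key: "p - \<Phi> (?q p) \<in> F.span ?R" for p
  proof (induction p rule: poly_mapping_single_induct)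
    case (single k c)
    obtain v w where k: "k = (v, w)" by (cases k)
    show ?case
      using F.span_scale[OF E[of v w], of c]
      by (simp add: k E_def q_single P.scale F.scale_right_diff_distrib)
  next
    case (sum p q)
    from F.span_add[OF sum.IH] show ?case by (simp add: Q.add P.add algebra_simps)
  qed
  show ?thesis
  proof (intro tensor_product.intro vector_space_fscale)
    show "tensor_product_axioms fscale fscale fscale ?t"
    proof
      show "surj ?q" by (metis q\<Phi> surjI)
      have rel: "?q p = 0" if "p \<in> ?R" for p
        using that by (auto simp: bilinearity_relations_def Q.diff q_single t_add t_scale)
      have "?q p = 0" if "p \<in> F.span ?R" for p
        by (rule Q.eq_0_on_span[OF rel that])
      moreover have "p \<in> F.span ?R" if "?q p = 0" for p
        using key[of p] by (simp only: that P.zero diff_zero)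
      ultimately show "{p. ?q p = 0} = F.span ?R" by blast
    qed
  qed
qed

text \<open>By uniqueness in the universal property it suffices that the linear extension agrees
  with \<open>b\<close> on pure tensors. Both are bilinear there, so basis vectors decide. The
  formula replaces the definite description in all later computations.\<close>

lemma tensor_lift_ftensor:
  assumes U: "vector_space s" and b: "bilinear_map fscale fscale s b"
  shows "tensor_lift fscale ftensor s b =
    linear_extension s (\<lambda>(x, y). b (Poly_Mapping.single x 1) (Poly_Mapping.single y 1))"
    (is "_ = ?h")
proof (rule tensor_product.tensor_lift_unique[OF tensor_product_ftensor U b])
  show h: "Vector_Spaces.linear fscale s ?h" by (rule linear_linear_extension[OF U])
  have b1: "Vector_Spaces.linear fscale s (b v)" and b2: "Vector_Spaces.linear fscale s (\<lambda>v. b v w)"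
    for v w using b by (auto simp: bilinear_map_def)
  interpret vector_space s by (rule U)
  show "?h (ftensor v w) = b v w" for v w
  proof (rule linear_eq_on_basis[OF linear_compose[OF ftensor_linear_left h] b2])
    fix x
    show "?h (ftensor (Poly_Mapping.single x 1) w) = b (Poly_Mapping.single x 1) w"
      by (rule linear_eq_on_basis[OF linear_compose[OF ftensor_linear_right h] b1])
        (simp add: linear_extension_single[OF U])
  qed
qed

lemma tensor_lift_ftensor_single:
  assumes "vector_space s" "bilinear_map fscale fscale s b"
  shows "tensor_lift fscale ftensor s b (Poly_Mapping.single (x, y) c) =
    s c (b (Poly_Mapping.single x 1) (Poly_Mapping.single y 1))"
  by (simp add: tensor_lift_ftensor[OF assms] linear_extension_single[OF assms(1)])

lemma linear_tensor_lift_ftensor: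
  assumes "vector_space s" "bilinear_map fscale fscale s b"
  shows "Vector_Spaces.linear fscale s (tensor_lift fscale ftensor s b)"
  unfolding tensor_lift_ftensor[OF assms] by (rule linear_linear_extension[OF assms(1)])

lemma bilinear_map_compose:
  assumes "bilinear_map s1 s2 s b" "Vector_Spaces.linear r1 s1 f" "Vector_Spaces.linear r2 s2 g"
  shows "bilinear_map r1 r2 s (\<lambda>x y. b (f x) (g y))"
  unfolding bilinear_map_def
proof (intro conjI allI)
  show "Vector_Spaces.linear r2 s (\<lambda>y. b (f x) (g y))" for x
    by (rule linear_compose[OF assms(3)]) (use assms(1) in \<open>simp add: bilinear_map_def\<close>)
  show "Vector_Spaces.linear r1 s (\<lambda>x. b (f x) (g y))" for y
    by (rule linear_compose[OF assms(2)]) (use assms(1) in \<open>simp add: bilinear_map_def\<close>)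
qed

lemma linear_fscale_id: "Vector_Spaces.linear fscale fscale id"
  by (rule linearI) (auto intro: vector_space_fscale)

lemma tensor_map_ftensor:
  assumes "Vector_Spaces.linear fscale fscale f" "Vector_Spaces.linear fscale fscale g"
  shows "Vector_Spaces.linear fscale fscale (tensor_map fscale ftensor fscale ftensor f g)"
    and "tensor_map fscale ftensor fscale ftensor f g (Poly_Mapping.single (x, y) c) =
      fscale c (ftensor (f (Poly_Mapping.single x 1)) (g (Poly_Mapping.single y 1)))"
  using bilinear_map_compose[OF bilinear_ftensor assms]
  by (simp_all add: tensor_map_def linear_tensor_lift_ftensor tensor_lift_ftensor_single
      vector_space_fscale)

text \<open>Both nested lifts are determined by basis vectors, where the associator merely
  rebrackets a triple of basis indices.\<close>

lemma tensor_assoc_ftensor: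
  "tensor_assoc fscale ftensor fscale ftensor fscale ftensor =
    linear_extension (fscale :: 'k::field \<Rightarrow> _) (\<lambda>((x, y), z). Poly_Mapping.single (x, (y, z)) 1)"
proof -
  have b: "bilinear_map fscale fscale fscale (\<lambda>x y. ftensor x (ftensor y z))" for z
    by (rule bilinear_map_compose[OF bilinear_ftensor linear_fscale_id[unfolded id_def]
        ftensor_linear_left])
  note V = vector_space_fscale
  note inner = tensor_lift_ftensor[OF V b]
  have "bilinear_map fscale fscale fscale
     (\<lambda>p z. tensor_lift fscale ftensor fscale (\<lambda>x y. ftensor x (ftensor y z)) p)"
    unfolding bilinear_map_def
  proof (intro conjI allI)
    show "Vector_Spaces.linear fscale fscale
        (\<lambda>p. tensor_lift fscale ftensor fscale (\<lambda>x y. ftensor x (ftensor y z)) p)" for z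
      unfolding inner by (rule linear_linear_extension[OF V])
    show "Vector_Spaces.linear fscale fscale
        (\<lambda>z. tensor_lift fscale ftensor fscale (\<lambda>x y. ftensor x (ftensor y z)) p)" for p
      unfolding inner
      by (rule linear_linear_extension_param)
        (auto split: prod.split intro: linear_compose[OF ftensor_linear_right ftensor_linear_right])
  qed
  then show ?thesis
    unfolding tensor_assoc_def
    by (subst tensor_lift_ftensor[OF V])
      (simp_all add: inner linear_extension_single[OF V] case_prod_unfold)
qed

section \<open>The tensor square of a monoid algebra\<close>

text \<open>Scalars embed as multiples of the unit, which turns homogeneity of the product into
  associativity. The version for multiplication from the right relies on the commutativity of the
  field.\<close>

lemma fscale_eq_mult_left:
  fixes p :: "'b::monoid_add \<Rightarrow>\<^sub>0 'k::field"
  shows "fscale c p = Poly_Mapping.single 0 c * p"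
  by (rule poly_mapping_eqI, induction p rule: poly_mapping_single_induct)
    (simp_all add: mult_single distrib_left lookup_add lookup_fscale)

lemma fscale_eq_mult_right:
  fixes p :: "'b::monoid_add \<Rightarrow>\<^sub>0 'k::field"
  shows "fscale c p = p * Poly_Mapping.single 0 c"
  by (rule poly_mapping_eqI, induction p rule: poly_mapping_single_induct)
    (simp_all add: mult_single distrib_right lookup_add lookup_fscale mult.commute distrib_left)

lemma bilinear_mult_poly_mapping:
  "bilinear_map fscale fscale fscale
    ((*) :: ('b::monoid_add \<Rightarrow>\<^sub>0 'k::field) \<Rightarrow> ('b \<Rightarrow>\<^sub>0 'k) \<Rightarrow> ('b \<Rightarrow>\<^sub>0 'k))"
  unfolding bilinear_map_def
proof (intro conjI allI)
  fix x :: "'b \<Rightarrow>\<^sub>0 'k"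
  show "Vector_Spaces.linear fscale fscale ((*) x)"
    by (rule linearI)
      (simp_all add: vector_space_fscale distrib_left fscale_eq_mult_right mult.assoc)
  show "Vector_Spaces.linear fscale fscale (\<lambda>y. y * x)"
    by (rule linearI)
      (simp_all add: vector_space_fscale distrib_right fscale_eq_mult_left mult.assoc)
qed

lemmas mult_linear_right =
  bilinear_mult_poly_mapping[unfolded bilinear_map_def, THEN conjunct1, rule_format]
lemmas mult_linear_left =
  bilinear_mult_poly_mapping[unfolded bilinear_map_def, THEN conjunct2, rule_format]

text \<open>The product on the right is that of the algebra of the product monoid \<open>'b \<times> 'b\<close>.\<close>

lemma tensor_mult_ftensor:
  fixes p q :: "'b::monoid_add \<times> 'b \<Rightarrow>\<^sub>0 'k::field"
  shows "tensor_mult fscale ftensor (*) p q = p * q"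
proof -
  note V = vector_space_fscale
  have b: "bilinear_map fscale fscale fscale (\<lambda>c d. ftensor (x * c) (y * d))"
    for x y :: "'b \<Rightarrow>\<^sub>0 'k"
    by (rule bilinear_map_compose[OF bilinear_ftensor mult_linear_right mult_linear_right])
  note inner = tensor_lift_ftensor[OF V b]
  let ?i = "\<lambda>x y. tensor_lift fscale ftensor fscale (\<lambda>c d. ftensor (x * c) (y * d)) q"
  have b2: "bilinear_map fscale fscale fscale ?i"
    unfolding bilinear_map_def inner
  proof (intro conjI allI; rule linear_linear_extension_param; clarify)
    fix x y c d :: "'b \<Rightarrow>\<^sub>0 'k"
    show "Vector_Spaces.linear fscale fscale (\<lambda>y. ftensor (x * c) (y * d))"
      by (rule linear_compose[OF mult_linear_left ftensor_linear_right])
    show "Vector_Spaces.linear fscale fscale (\<lambda>x. ftensor (x * c) (y * d))"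
      by (rule linear_compose[OF mult_linear_left ftensor_linear_left])
  qed
  \<comment> \<open>For a fixed basis tensor on the left, the inner lift is left multiplication by
    it: on basis tensors both add indices componentwise.\<close>
  have i: "?i (Poly_Mapping.single x 1) (Poly_Mapping.single y 1) =
      Poly_Mapping.single (x, y) 1 * q" for x y
    by (rule linear_eq_on_basis[OF linear_tensor_lift_ftensor[OF V b] mult_linear_right])
      (auto simp: inner linear_extension_single[OF V] mult_single)
  show ?thesis
    unfolding tensor_mult_def
    by (rule linear_eq_on_basis[OF linear_tensor_lift_ftensor[OF V b2] mult_linear_left])
      (auto simp: tensor_lift_ftensor_single[OF V b2] i)
qed

section \<open>Factorizations of weak sentences\<close>

definition splits :: "'a list \<Rightarrow> ('a list \<times> 'a list) set" where
  "splits w = {(u, v). u @ v = w}"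

text \<open>Both halves are recorded, although the second determines the first, so that sums over
  cuts can be split recursively and regrouped from either side.\<close>

definition factorizations :: "'a list list \<Rightarrow> ('a list list \<times> 'a list list) set" where
  "factorizations I = {(U, J). factors I U J}"

lemma finite_splits [simp]: "finite (splits w)"
proof (rule finite_subset)
  show "splits w \<subseteq> (\<lambda>n. (take n w, drop n w)) ` {..length w}"
  proof
    fix x assume "x \<in> splits w"
    then have "x = (take (length (fst x)) w, drop (length (fst x)) w)" "length (fst x) \<le> length w"
      by (auto simp: splits_def)
    then show "x \<in> (\<lambda>n. (take n w, drop n w)) ` {..length w}" by blast
  qed
qed simp

lemma splits_Nil [simp]: "splits [] = {([], [])}"
  by (auto simp: splits_def)

lemma factors_Cons:
  "factors (w # I) U J \<longleftrightarrow>
    (\<exists>u U' v J'. U = u # U' \<and> J = v # J' \<and> w = u @ v \<and> factors I U' J')"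
  by (cases U; cases J) (auto simp: factors_def less_Suc_eq_0_disj nth_Cons split: nat.splits)

lemma factorizations_Nil [simp]: "factorizations [] = {([], [])}"
  by (auto simp: factorizations_def factors_def)

lemma factorizations_Cons:
  "factorizations (w # I) =
    (\<lambda>((u, v), (U, V)). (u # U, v # V)) ` (splits w \<times> factorizations I)"
  by (auto simp: factorizations_def splits_def factors_Cons image_iff)

lemma finite_factorizations [simp]: "finite (factorizations I)"
  by (induction I) (simp_all add: factorizations_Cons)

text \<open>The first word and the remaining words are cut independently, so the factorizations are
  in bijection with a product set.\<close>

lemma sum_factorizations_Cons:
  "(\<Sum>(U, V)\<in>factorizations (w # I). f U V) =
    (\<Sum>(u, v)\<in>splits w. \<Sum>(U, V)\<in>factorizations I. f (u # U) (v # V))"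
  unfolding factorizations_Cons
  by (subst sum.reindex)
    (auto simp: inj_on_def sum.cartesian_product case_prod_unfold intro!: sum.cong)

lemma sum_factorizations_append:
  "(\<Sum>(U, V)\<in>factorizations (I @ J). f U V) =
    (\<Sum>(U, V)\<in>factorizations I. \<Sum>(U', V')\<in>factorizations J. f (U @ U') (V @ V'))"
  by (induction I arbitrary: f) (simp_all add: sum_factorizations_Cons)

lemma sum_factorizations_filter:
  "(\<Sum>(U, V)\<in>factorizations (filter (\<lambda>w. w \<noteq> []) I).
      f (filter (\<lambda>w. w \<noteq> []) U) (filter (\<lambda>w. w \<noteq> []) V)) =
    (\<Sum>(U, V)\<in>factorizations I. f (filter (\<lambda>w. w \<noteq> []) U) (filter (\<lambda>w. w \<noteq> []) V))"
proof (induction I arbitrary: f)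
  case (Cons w I)
  let ?d = "filter (\<lambda>w. w \<noteq> [])"
  have "(\<Sum>(U, V)\<in>factorizations (?d I). f (?d (u # U)) (?d (v # V))) =
      (\<Sum>(U, V)\<in>factorizations I. f (?d (u # U)) (?d (v # V)))" for u v
    \<comment> \<open>The halves of the first word are absorbed into the summand, which is why the
      induction generalizes over \<open>f\<close>. Prepending the filtered singletons covers empty
      and non-empty halves alike.\<close>
    using Cons.IH[of "\<lambda>U V. f (?d [u] @ U) (?d [v] @ V)"]
    by (cases "u = []"; cases "v = []") simp_all
  note IH = this
  show ?case
  proof (cases "w = []")
    case True
    then show ?thesis using IH[of "[]" "[]"] by (simp add: sum_factorizations_Cons)
  next
    case False
    then have "?d (w # I) = w # ?d I" by simp
    then show ?thesis by (simp only: sum_factorizations_Cons IH)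
  qed
qed simp

text \<open>Both sides run over the triples \<open>A\<close>, \<open>B\<close>, \<open>C\<close>
  whose wordwise concatenation is \<open>I\<close>. The bijection regroups a triple; the
  intermediate half is recovered as the wordwise concatenation of \<open>A\<close> and
  \<open>B\<close>, or of \<open>B\<close> and \<open>C\<close>.\<close>

lemma sum_factorizations_assoc:
  "(\<Sum>(U, C)\<in>factorizations I. \<Sum>(A, B)\<in>factorizations U. f A B C) =
    (\<Sum>(A, V)\<in>factorizations I. \<Sum>(B, C)\<in>factorizations V. f A B C)"
proof -
  have "(\<Sum>x\<in>factorizations I. \<Sum>y\<in>factorizations (fst x). f (fst y) (snd y) (snd x)) =
    (\<Sum>x\<in>factorizations I. \<Sum>y\<in>factorizations (snd x). f (fst x) (fst y) (snd y))"
    by (subst (1 2) sum.Sigma, simp_all,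
      rule sum.reindex_bij_witness
        [where i = "\<lambda>((A, V), (B, C)). ((map2 (@) A B, C), (A, B))"
          and j = "\<lambda>((U, C), (A, B)). ((A, map2 (@) B C), (B, C))"])
      (auto simp: factorizations_def factors_def intro!: nth_equalityI)
  then show ?thesis by (simp add: case_prod_unfold)
qed

section \<open>The coproduct of sentences\<close>

lemma words_drop_empty_words [simp]:
  "words (drop_empty_words W) = filter (\<lambda>w. w \<noteq> []) W"
  by (rule drop_empty_words.rep_eq)

lemma drop_empty_words_words [simp]: "drop_empty_words (words I) = I"
  by transfer (auto simp: filter_id_conv)

lemma drop_empty_words_Nil [simp]: "drop_empty_words [] = 0"
  by transfer simp

lemma drop_empty_words_append [simp]:
  "drop_empty_words (U @ V) = drop_empty_words U + drop_empty_words V"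
  by transfer simp

lemma drop_empty_words_filter [simp]:
  "drop_empty_words (filter (\<lambda>w. w \<noteq> []) W) = drop_empty_words W"
  by transfer simp

lemma drop_empty_words_eq_0_iff: "drop_empty_words W = 0 \<longleftrightarrow> (\<forall>w\<in>set W. w = [])"
  by transfer (auto simp: filter_empty_conv)

text \<open>Empty left halves force each right half to be the whole word. This and its mirror image
  isolate the one term that survives under the counit.\<close>

lemma factorizations_left_empty_iff:
  assumes "x \<in> factorizations I"
  shows "(\<forall>w\<in>set (fst x). w = []) \<longleftrightarrow> x = (replicate (length I) [], I)"
  using assms
  by (cases x) (auto simp: factorizations_def factors_def all_set_conv_all_nth
      intro!: nth_equalityI)

lemma factorizations_right_empty_iff:
  assumes "x \<in> factorizations I"
  shows "(\<forall>w\<in>set (snd x). w = []) \<longleftrightarrow> x = (I, replicate (length I) [])"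
  using assms
  by (cases x) (auto simp: factorizations_def factors_def all_set_conv_all_nth
      intro!: nth_equalityI)

section \<open>Coproduct and counit on basis sentences\<close>

lemma linear_sentence_comult: "Vector_Spaces.linear fscale fscale sentence_comult"
  unfolding sentence_comult_def by (rule linear_linear_extension[OF vector_space_fscale])

text \<open>A contained weak sentence determines its remainder, so pairing the two is a bijection
  from the index set of the coproduct onto the factorizations.\<close>

lemma sentence_comult_single:
  "sentence_comult (Poly_Mapping.single I (1 :: 'k::field)) =
    (\<Sum>(U, V)\<in>factorizations (words I).
      Poly_Mapping.single (drop_empty_words U, drop_empty_words V) 1)"
  unfolding sentence_comult_def linear_extension_single[OF vector_space_fscale] fscale_one
  by (rule sum.reindex_bij_witness[where i = snd and j = "\<lambda>J. (remainder I J, J)"])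
    (auto simp: factorizations_def contained_def dest: remainder_eqI)

lemma sum_factorizations_drop_empty_words:
  "(\<Sum>(U, V)\<in>factorizations (filter (\<lambda>w. w \<noteq> []) W). f (drop_empty_words U) (drop_empty_words V)) =
    (\<Sum>(U, V)\<in>factorizations W. f (drop_empty_words U) (drop_empty_words V))"
  using sum_factorizations_filter[of "\<lambda>U V. f (drop_empty_words U) (drop_empty_words V)" W]
  by simp

text \<open>The halves of a cut are weak sentences. Here the coproduct of such a half is expanded
  without deleting its empty words first, so that iterated cuts can be compared.\<close>

lemma sentence_comult_drop_empty_words:
  "sentence_comult (Poly_Mapping.single (drop_empty_words W) (1 :: 'k::field)) =
    (\<Sum>(U, V)\<in>factorizations W. Poly_Mapping.single (drop_empty_words U, drop_empty_words V) 1)"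
  by (simp add: sentence_comult_single
      sum_factorizations_drop_empty_words[of "\<lambda>U V. Poly_Mapping.single (U, V) 1"])

lemma linear_sentence_counit: "Vector_Spaces.linear fscale (*) sentence_counit"
  unfolding sentence_counit_def by (rule linear_linear_extension[OF vector_space_times])

lemma sentence_counit_single:
  "sentence_counit (Poly_Mapping.single I c) = (if I = 0 then c else 0)"
  by (simp add: sentence_counit_def linear_extension_single[OF vector_space_times])

section \<open>Coassociativity\<close>

lemma sentence_coassoc:
  fixes x :: "('a, 'k::field) sentence_algebra"
  shows "tensor_assoc fscale ftensor fscale ftensor fscale ftensor
      (tensor_map fscale ftensor fscale ftensor sentence_comult id (sentence_comult x)) =
    tensor_map fscale ftensor fscale ftensor id sentence_comult (sentence_comult x)"
proof -
  note V = vector_space_fscale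
  note l = linear_sentence_comult
  note L = tensor_map_ftensor[OF l linear_fscale_id] and R = tensor_map_ftensor[OF linear_fscale_id l]
  note A = linear_linear_extension[OF V, of "\<lambda>((x, y), z). Poly_Mapping.single (x, (y, z)) 1"]
  \<comment> \<open>The final simplification rewrites patterns into projections, so linearity of the
    rebracketing map is kept in that form as well.\<close>
  note A' = A[unfolded case_prod_unfold]
  note linear_sums = linear_sumD[OF L(1)] linear_sumD[OF R(1)] linear_sumD[OF A']
    linear_sumD[OF ftensor_linear_left] linear_sumD[OF ftensor_linear_right]
  show ?thesis
    unfolding tensor_assoc_ftensor
  proof (rule linear_eq_on_basis[OF linear_compose[OF linear_compose[OF l L(1)] A]
        linear_compose[OF l R(1)]])
    fix I :: "'a sentence"
    show "linear_extension fscale (\<lambda>((x, y), z). Poly_Mapping.single (x, (y, z)) (1 :: 'k))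
        (tensor_map fscale ftensor fscale ftensor sentence_comult id
          (sentence_comult (Poly_Mapping.single I 1))) =
      tensor_map fscale ftensor fscale ftensor id sentence_comult
        (sentence_comult (Poly_Mapping.single I 1))"
      using sum_factorizations_assoc[of "\<lambda>A B C. Poly_Mapping.single
          (drop_empty_words A, drop_empty_words B, drop_empty_words C) (1 :: 'k)" "words I"]
      by (simp add: sentence_comult_single[of I] linear_sums L(2) R(2)
          sentence_comult_drop_empty_words linear_extension_single[OF V] case_prod_unfold)
  qed
qed

section \<open>Counit laws\<close>

lemma bilinear_counit_left:
  assumes "Vector_Spaces.linear fscale (*) e"
  shows "bilinear_map fscale fscale fscale (\<lambda>v w. fscale (e v) w)"
  unfolding bilinear_map_def
  by (intro conjI allI; rule linearI)
    (auto intro!: poly_mapping_eqI simp: vector_space_fscale lookup_fscale lookup_add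
      linear_addD[OF assms] linear_scaleD[OF assms] algebra_simps)

lemma bilinear_counit_right:
  assumes "Vector_Spaces.linear fscale (*) e"
  shows "bilinear_map fscale fscale fscale (\<lambda>v w. fscale (e w) v)"
  using bilinear_counit_left[OF assms] by (auto simp: bilinear_map_def)

lemma sum_factorizations_left_empty:
  "(\<Sum>(U, V)\<in>factorizations (words I).
      if drop_empty_words U = 0 then f (drop_empty_words V) else 0) = f I"
proof -
  have "(\<Sum>(U, V)\<in>factorizations (words I).
        if drop_empty_words U = 0 then f (drop_empty_words V) else 0) =
      (\<Sum>x\<in>factorizations (words I). if x = (replicate (length (words I)) [], words I) then f I else 0)"
    by (rule sum.cong[OF refl])
      (simp add: case_prod_unfold drop_empty_words_eq_0_iff factorizations_left_empty_iff)
  moreover have "(replicate (length (words I)) [], words I) \<in> factorizations (words I)"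
    by (simp add: factorizations_def factors_def)
  ultimately show ?thesis by simp
qed

lemma sum_factorizations_right_empty:
  "(\<Sum>(U, V)\<in>factorizations (words I).
      if drop_empty_words V = 0 then f (drop_empty_words U) else 0) = f I"
proof -
  have "(\<Sum>(U, V)\<in>factorizations (words I).
        if drop_empty_words V = 0 then f (drop_empty_words U) else 0) =
      (\<Sum>x\<in>factorizations (words I). if x = (words I, replicate (length (words I)) []) then f I else 0)"
    by (rule sum.cong[OF refl])
      (simp add: case_prod_unfold drop_empty_words_eq_0_iff factorizations_right_empty_iff)
  moreover have "(words I, replicate (length (words I)) []) \<in> factorizations (words I)"
    by (simp add: factorizations_def factors_def)
  ultimately show ?thesis by simp
qed

lemma sentence_counit_left:
  fixes x :: "('a, 'k::field) sentence_algebra"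
  shows "tensor_lift fscale ftensor fscale (\<lambda>v w. fscale (sentence_counit v) w) (sentence_comult x) = x"
proof -
  note V = vector_space_fscale
  note b = bilinear_counit_left[OF linear_sentence_counit]
  note l = linear_tensor_lift_ftensor[OF V b]
  \<comment> \<open>The case distinction is kept outside the basis vector, the shape in which the
    sum collapses to one term; \<open>fscale_single\<close> would push it into the
    coefficient.\<close>
  have eq: "fscale (if P then 1 else 0) (Poly_Mapping.single J 1) =
      (if P then Poly_Mapping.single J 1 else (0 :: ('a, 'k) sentence_algebra))" for P J
    by simp
  show ?thesis
    by (rule linear_eq_on_basis[OF linear_compose[OF linear_sentence_comult l]
          linear_fscale_id, unfolded id_def])
      (use sum_factorizations_left_empty[of "\<lambda>V. Poly_Mapping.single V (1 :: 'k)"] in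
        \<open>simp add: sentence_comult_single linear_sumD[OF l] case_prod_unfold
          tensor_lift_ftensor_single[OF V b] sentence_counit_single eq del: fscale_single\<close>)
qed

lemma sentence_counit_right:
  fixes x :: "('a, 'k::field) sentence_algebra"
  shows "tensor_lift fscale ftensor fscale (\<lambda>v w. fscale (sentence_counit w) v) (sentence_comult x) = x"
proof -
  note V = vector_space_fscale
  note b = bilinear_counit_right[OF linear_sentence_counit]
  note l = linear_tensor_lift_ftensor[OF V b]
  have eq: "fscale (if P then 1 else 0) (Poly_Mapping.single J 1) =
      (if P then Poly_Mapping.single J 1 else (0 :: ('a, 'k) sentence_algebra))" for P J
    by simp
  show ?thesis
    by (rule linear_eq_on_basis[OF linear_compose[OF linear_sentence_comult l]
          linear_fscale_id, unfolded id_def])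
      (use sum_factorizations_right_empty[of "\<lambda>V. Poly_Mapping.single V (1 :: 'k)"] in
        \<open>simp add: sentence_comult_single linear_sumD[OF l] case_prod_unfold
          tensor_lift_ftensor_single[OF V b] sentence_counit_single eq del: fscale_single\<close>)
qed

section \<open>Multiplicativity of the coproduct and the counit\<close>

lemma bilinear_eq_on_basis:
  assumes b: "bilinear_map fscale fscale s b" and c: "bilinear_map fscale fscale s c"
    and eq: "\<And>x y. b (Poly_Mapping.single x 1) (Poly_Mapping.single y 1) =
      c (Poly_Mapping.single x 1) (Poly_Mapping.single y 1)"
  shows "b p q = c p q"
  by (rule linear_eq_on_basis[of s "\<lambda>p. b p q" "\<lambda>p. c p q"])
    (use assms in \<open>auto simp: bilinear_map_def intro: linear_eq_on_basis\<close>)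

lemma bilinear_compose_linear:
  assumes "bilinear_map s1 s2 s b" "Vector_Spaces.linear s r f"
  shows "bilinear_map s1 s2 r (\<lambda>x y. f (b x y))"
  unfolding bilinear_map_def
proof (intro conjI allI)
  show "Vector_Spaces.linear s2 r (\<lambda>y. f (b x y))" for x
    by (rule linear_compose[OF _ assms(2)]) (use assms(1) in \<open>simp add: bilinear_map_def\<close>)
  show "Vector_Spaces.linear s1 r (\<lambda>x. f (b x y))" for y
    by (rule linear_compose[OF _ assms(2)]) (use assms(1) in \<open>simp add: bilinear_map_def\<close>)
qed

text \<open>On basis sentences, cuts of a concatenation are pairs of cuts, and deleting empty words
  respects concatenation. The product on the right adds pairs of sentences componentwise.\<close>

lemma sentence_comult_mult:
  fixes x y :: "('a, 'k::field) sentence_algebra"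
  shows "sentence_comult (x * y) = sentence_comult x * sentence_comult y"
proof (rule bilinear_eq_on_basis[OF
      bilinear_compose_linear[OF bilinear_mult_poly_mapping linear_sentence_comult]
      bilinear_map_compose[OF bilinear_mult_poly_mapping linear_sentence_comult linear_sentence_comult]])
  show "sentence_comult (Poly_Mapping.single I 1 * Poly_Mapping.single J (1 :: 'k)) =
      sentence_comult (Poly_Mapping.single I 1) * sentence_comult (Poly_Mapping.single J 1)"
    for I J :: "'a sentence"
    by (simp add: mult_single sentence_comult_single plus_sentence.rep_eq sum_product
        sum_factorizations_append[of "\<lambda>U V. Poly_Mapping.single
          (drop_empty_words U, drop_empty_words V) (1 :: 'k)", unfolded case_prod_unfold]
        case_prod_unfold)
qed

text \<open>A concatenation is empty exactly when both factors are, which settles basis sentences;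
  bilinearity does the rest.\<close>

lemma sentence_counit_mult:
  fixes x y :: "('a, 'k::field) sentence_algebra"
  shows "sentence_counit (x * y) = sentence_counit x * sentence_counit y"
proof -
  have "bilinear_map (*) (*) (*) ((*) :: 'k \<Rightarrow> _)"
    unfolding bilinear_map_def
    by (intro conjI allI; rule linearI) (auto simp: vector_space_times algebra_simps)
  note m = bilinear_map_compose[OF this linear_sentence_counit linear_sentence_counit]
  have "I + J = 0 \<longleftrightarrow> I = 0 \<and> J = 0" for I J :: "'a sentence"
    by transfer simp
  then have "sentence_counit (Poly_Mapping.single I 1 * Poly_Mapping.single J (1 :: 'k)) =
      sentence_counit (Poly_Mapping.single I 1) * sentence_counit (Poly_Mapping.single J 1)"
    for I J :: "'a sentence"
    by (simp add: mult_single sentence_counit_single)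
  then show ?thesis
    by (rule bilinear_eq_on_basis[OF
          bilinear_compose_linear[OF bilinear_mult_poly_mapping linear_sentence_counit] m])
qed

theorem proposition3p4:
  shows "bialgebra
    (fscale :: 'k::field_char_0 \<Rightarrow> ('a::finite, 'k) sentence_algebra \<Rightarrow> ('a, 'k) sentence_algebra)
    fscale ftensor
    fscale ftensor
    fscale ftensor
    (*) sentence_unit sentence_comult sentence_counit"
proof (intro bialgebra.intro unital_algebra.intro coalgebra.intro vector_space_fscale
    tensor_product_ftensor)
  show "unital_algebra_axioms fscale (*) (sentence_unit :: 'k \<Rightarrow> ('a, 'k) sentence_algebra)"
  proof (rule unital_algebra_axioms.intro)
    show "Vector_Spaces.linear (*) fscale (sentence_unit :: 'k \<Rightarrow> ('a, 'k) sentence_algebra)"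
      by (rule linearI)
        (auto simp: sentence_unit_def single_add vector_space_fscale vector_space_times)
  \<comment> \<open>The unit laws are the description of scaling as multiplication by a multiple of
    the empty sentence, read from right to left.\<close>
  qed (auto simp: bilinear_mult_poly_mapping mult.assoc sentence_unit_def
      simp flip: fscale_eq_mult_left fscale_eq_mult_right)
  show "coalgebra_axioms (fscale :: 'k \<Rightarrow> ('a, 'k) sentence_algebra \<Rightarrow> _)
      fscale ftensor fscale ftensor fscale ftensor sentence_comult sentence_counit"
    by (rule coalgebra_axioms.intro)
      (simp_all add: linear_sentence_comult linear_sentence_counit sentence_coassoc
        sentence_counit_left sentence_counit_right)
  \<comment> \<open>\<open>tensor_mult_ftensor\<close> replaces the product of the tensor square by
    that of the product monoid's algebra. With \<open>single_one\<close> disabled, the unit remains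
    a visible basis vector to which the formulas for basis sentences apply.\<close>
  show "bialgebra_axioms fscale ftensor (*) (sentence_unit :: 'k \<Rightarrow> ('a, 'k) sentence_algebra)
      sentence_comult sentence_counit"
    by (rule bialgebra_axioms.intro)
      (simp_all add: sentence_comult_mult tensor_mult_ftensor sentence_counit_mult sentence_unit_def
        sentence_counit_single sentence_comult_single zero_sentence.rep_eq del: single_one)
qed

end
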